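(* Let $K\subseteq k((G))$ be a Hahn field satisfying the canonical second lifting property. Then $\mathrm{IntAut}\,K$ (respectively $\mathrm{IntAut}_kK$) admits the following inner semi-direct product decomposition (left factor normal): \begin{align*} \mathrm{IntAut}\,K&=1\text{-}\mathrm{Aut}\,K\rtimes G\text{-}\mathrm{Exp}\,K,\\ \mathrm{IntAut}_{(k)}K=\mathrm{IntAut}_kK&=1\text{-}\mathrm{Aut}_kK\rtimes G\text{-}\mathrm{Exp}\,K. \end{align*}
   Context: Let $k$ be a field and $(G,+,<)$ a totally ordered abelian group. $\mathbb K=k((G))$ is the field of all formal series $a=\sum_{g\in G}a_gt^g$ ($a_g\in k$) whose support $\operatorname{supp}a=\{g:a_g\neq 0\}$ is well ordered, with termwise addition and convolution product. $k(G)\subseteq\mathbb K$ is the fraction field of the group ring $k[G]$ (series with finite support). A Hahn field is a field $K$ with $k(G)\subseteq K\subseteq \mathbb K$. It carries the valuation $v(a)=\min\operatorname{supp}a$ for $a\neq0$, $v(0)=\infty$, with value group $G$, valuation ring $R_K=\{v\geq0\}$ and valuation ideal $I_K=\{v>0\}$. $v\text{-}\mathrm{Aut}\,K$ is the group of field automorphisms $\sigma$ of $K$ for which there is an order preserving automorphism $\sigma_G$ of $G$ with $\sigma_G(v(a))=v(\sigma(a))$ for all $a\in K^\times$. Such $\sigma$ induces the automorphism $\bar\sigma(a+I_K)=\sigma(a)+I_K$ of the residue field $R_K/I_K$. The group of internal automorphisms is $\mathrm{IntAut}\,K:=\{\sigma\in v\text{-}\mathrm{Aut}\,K:\sigma_G=\mathrm{id},\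 \bar\sigma=\mathrm{id}\}$. For any group of automorphisms of $K$, the subscript $(k)$ denotes the subgroup of those $\sigma$ with $\sigma(k)=k$, the subscript $k$ the subgroup of those with $\sigma|_k=\mathrm{id}_k$. $\mathrm{Hom}(G,k^\times)$ is the group, under pointwise multiplication, of homomorphisms $x\colon(G,+)\to(k^\times,\cdot)$, $x^g:=x(g)$. $K$ has the canonical second lifting property if $x\mapsto\rho_x$, $\rho_x(\sum a_gt^g)=\sum a_gx^gt^g$, is a well defined group homomorphism $\mathrm{Hom}(G,k^\times)\to\mathrm{IntAut}\,K$; its image is the group $G\text{-}\mathrm{Exp}\,K$ of $G$-exponentiations. The group of 1-automorphisms is $1\text{-}\mathrm{Aut}\,K:=\{\sigma\in\mathrm{IntAut}\,K:\sigma(t^g)_g=1\text{ for all }g\in G\}$, i.e. the kernel of the homomorphism $\mathrm{IntAut}\,K\to\mathrm{Hom}(G,k^\times)$, $\sigma\mapsto(g\mapsto\sigma(t^g)_g)$ (where $a_g$ denotes the coefficient of $t^g$ in $a$). *)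

theory Defs
  imports "HOL-Algebra.QuotRing" "HOL-Algebra.Bij" "HOL-Library.Extended"
begin

section \<open>Generalized power series\<close>

definition supp :: "('g \<Rightarrow> 'k::zero) \<Rightarrow> 'g set" where
  "supp a = {g. a g \<noteq> 0}"

definition monomial :: "'k::zero \<Rightarrow> 'g \<Rightarrow> ('g \<Rightarrow> 'k)" where
  "monomial c g = (\<lambda>h. if h = g then c else 0)"

abbreviation tpow :: "'g \<Rightarrow> ('g \<Rightarrow> 'k::zero_neq_one)" where
  "tpow g \<equiv> monomial 1 g"

text \<open>The order on the exponents is total, so \<open>wfp_on (supp a) (<)\<close> says that the support
  is well ordered. For two such series the sum in the convolution product is finite, see
  \<open>finite_convolution\<close> below.\<close>

definition hahn_ring :: "('g::linordered_ab_group_add \<Rightarrow> 'k::field) ring" where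
  "hahn_ring =
    \<lparr>carrier = {a. wfp_on (supp a) (<)},
     monoid.mult = (\<lambda>a b g. \<Sum>h | h \<in> supp a \<and> g - h \<in> supp b. a h * b (g - h)),
     one = monomial 1 0,
     zero = (\<lambda>g. 0),
     add = (\<lambda>a b g. a g + b g)\<rparr>"

definition group_ring :: "('g::linordered_ab_group_add \<Rightarrow> 'k::field) set" where
  "group_ring = {a. finite (supp a)}"

definition rational_series :: "('g::linordered_ab_group_add \<Rightarrow> 'k::field) set" where
  "rational_series = {a \<in> carrier hahn_ring.
     \<exists>p\<in>group_ring. \<exists>q\<in>group_ring. q \<noteq> \<zero>\<^bsub>hahn_ring\<^esub> \<and> q \<otimes>\<^bsub>hahn_ring\<^esub> a = p}"

definition constants :: "('g::linordered_ab_group_add \<Rightarrow> 'k::field) set" where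
  "constants = range (\<lambda>c. monomial c 0)"

abbreviation sub_hahn ::
    "('g::linordered_ab_group_add \<Rightarrow> 'k::field) set \<Rightarrow> ('g \<Rightarrow> 'k) ring" where
  "sub_hahn A \<equiv> hahn_ring\<lparr>carrier := A\<rparr>"

definition hahn_field :: "('g::linordered_ab_group_add \<Rightarrow> 'k::field) set \<Rightarrow> bool" where
  "hahn_field K \<longleftrightarrow>
     field (sub_hahn K) \<and> rational_series \<subseteq> K \<and> K \<subseteq> carrier hahn_ring"

section \<open>The valuation\<close>

text \<open>Only the values \<open>Fin g\<close> and \<open>Pinf\<close> occur.\<close>

definition val :: "('g::linordered_ab_group_add \<Rightarrow> 'k::field) \<Rightarrow> 'g extended" where
  "val a = (if a = \<zero>\<^bsub>hahn_ring\<^esub> then Pinf else Fin (LEAST g. g \<in> supp a))"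

definition val_ring ::
    "('g::linordered_ab_group_add \<Rightarrow> 'k::field) set \<Rightarrow> ('g \<Rightarrow> 'k) set" where
  "val_ring K = {a \<in> K. 0 \<le> val a}"

definition val_ideal ::
    "('g::linordered_ab_group_add \<Rightarrow> 'k::field) set \<Rightarrow> ('g \<Rightarrow> 'k) set" where
  "val_ideal K = {a \<in> K. 0 < val a}"

definition residue_field ::
    "('g::linordered_ab_group_add \<Rightarrow> 'k::field) set \<Rightarrow> ('g \<Rightarrow> 'k) set ring" where
  "residue_field K = sub_hahn (val_ring K) Quot val_ideal K"

section \<open>Automorphisms\<close>

text \<open>As in \<^const>\<open>Bij\<close>, maps on \<open>K\<close> are taken to be extensional, so that groups of automorphisms
  are subgroups of \<^const>\<open>BijGroup\<close>.\<close>

definition field_Aut ::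
    "('g::linordered_ab_group_add \<Rightarrow> 'k::field) set \<Rightarrow> (('g \<Rightarrow> 'k) \<Rightarrow> ('g \<Rightarrow> 'k)) set" where
  "field_Aut K = extensional K \<inter> ring_iso (sub_hahn K) (sub_hahn K)"

definition order_aut :: "('g::linordered_ab_group_add \<Rightarrow> 'g) \<Rightarrow> bool" where
  "order_aut s \<longleftrightarrow> bij s \<and> (\<forall>g h. s (g + h) = s g + s h) \<and> mono s"

text \<open>\<open>induces_on_values K \<sigma> s\<close> says that \<open>s\<close> is the automorphism of the value group induced
  by \<open>\<sigma>\<close>; such an \<open>s\<close> is unique, see \<open>induces_on_values_unique\<close> below.\<close>

definition induces_on_values ::
    "('g::linordered_ab_group_add \<Rightarrow> 'k::field) set \<Rightarrow> (('g \<Rightarrow> 'k) \<Rightarrow> ('g \<Rightarrow> 'k)) \<Rightarrow> ('g \<Rightarrow> 'g) \<Rightarrow> bool"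
  where
  "induces_on_values K \<sigma> s \<longleftrightarrow>
     order_aut s \<and> (\<forall>a \<in> K - {\<zero>\<^bsub>hahn_ring\<^esub>}. map_extended s (val a) = val (\<sigma> a))"

definition v_Aut ::
    "('g::linordered_ab_group_add \<Rightarrow> 'k::field) set \<Rightarrow> (('g \<Rightarrow> 'k) \<Rightarrow> ('g \<Rightarrow> 'k)) set" where
  "v_Aut K = {\<sigma> \<in> field_Aut K. \<exists>s. induces_on_values K \<sigma> s}"

text \<open>The map \<open>a + I\<^sub>K \<mapsto> \<sigma> a + I\<^sub>K\<close>, see \<open>residue_aut_coset\<close> below.\<close>

definition residue_aut ::
    "('g::linordered_ab_group_add \<Rightarrow> 'k::field) set \<Rightarrow> (('g \<Rightarrow> 'k) \<Rightarrow> ('g \<Rightarrow> 'k))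
      \<Rightarrow> ('g \<Rightarrow> 'k) set \<Rightarrow> ('g \<Rightarrow> 'k) set" where
  "residue_aut K \<sigma> = (\<lambda>C \<in> carrier (residue_field K).
     the_elem ((\<lambda>a. val_ideal K +>\<^bsub>sub_hahn (val_ring K)\<^esub> \<sigma> a) ` C))"

definition IntAut ::
    "('g::linordered_ab_group_add \<Rightarrow> 'k::field) set \<Rightarrow> (('g \<Rightarrow> 'k) \<Rightarrow> ('g \<Rightarrow> 'k)) set" where
  "IntAut K = {\<sigma> \<in> v_Aut K. induces_on_values K \<sigma> id \<and>
     residue_aut K \<sigma> = (\<lambda>C \<in> carrier (residue_field K). C)}"

definition one_Aut ::
    "('g::linordered_ab_group_add \<Rightarrow> 'k::field) set \<Rightarrow> (('g \<Rightarrow> 'k) \<Rightarrow> ('g \<Rightarrow> 'k)) set" where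
  "one_Aut K = {\<sigma> \<in> IntAut K. \<forall>g. \<sigma> (tpow g) g = 1}"

definition stabilizing_constants ::
    "(('g::linordered_ab_group_add \<Rightarrow> 'k::field) \<Rightarrow> ('g \<Rightarrow> 'k)) set \<Rightarrow> (('g \<Rightarrow> 'k) \<Rightarrow> ('g \<Rightarrow> 'k)) set"
  where
  "stabilizing_constants A = {\<sigma> \<in> A. \<sigma> ` constants = constants}"

definition fixing_constants ::
    "(('g::linordered_ab_group_add \<Rightarrow> 'k::field) \<Rightarrow> ('g \<Rightarrow> 'k)) set \<Rightarrow> (('g \<Rightarrow> 'k) \<Rightarrow> ('g \<Rightarrow> 'k)) set"
  where
  "fixing_constants A = {\<sigma> \<in> A. \<forall>c \<in> constants. \<sigma> c = c}"

definition aut_group ::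
    "('g \<Rightarrow> 'k) set \<Rightarrow> (('g \<Rightarrow> 'k) \<Rightarrow> ('g \<Rightarrow> 'k)) set \<Rightarrow> (('g \<Rightarrow> 'k) \<Rightarrow> ('g \<Rightarrow> 'k)) monoid" where
  "aut_group K A = (BijGroup K)\<lparr>carrier := A\<rparr>"

section \<open>Exponentiations and the second lifting property\<close>

definition character_group :: "('g::linordered_ab_group_add \<Rightarrow> 'k::field) monoid" where
  "character_group =
    \<lparr>carrier = {x. (\<forall>g. x g \<noteq> 0) \<and> (\<forall>g h. x (g + h) = x g * x h)},
     monoid.mult = (\<lambda>x y g. x g * y g),
     one = (\<lambda>g. 1)\<rparr>"

definition exponentiation ::
    "('g \<Rightarrow> 'k::field) set \<Rightarrow> ('g \<Rightarrow> 'k) \<Rightarrow> (('g \<Rightarrow> 'k) \<Rightarrow> ('g \<Rightarrow> 'k))" where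
  "exponentiation K x = (\<lambda>a \<in> K. \<lambda>g. a g * x g)"

definition canonical_second_lifting ::
    "('g::linordered_ab_group_add \<Rightarrow> 'k::field) set \<Rightarrow> bool" where
  "canonical_second_lifting K \<longleftrightarrow>
     exponentiation K \<in> hom character_group (aut_group K (IntAut K))"

definition G_Exp ::
    "('g::linordered_ab_group_add \<Rightarrow> 'k::field) set \<Rightarrow> (('g \<Rightarrow> 'k) \<Rightarrow> ('g \<Rightarrow> 'k)) set" where
  "G_Exp K = exponentiation K ` carrier character_group"

definition inner_semidirect :: "('a, 'b) monoid_scheme \<Rightarrow> 'a set \<Rightarrow> 'a set \<Rightarrow> bool" where
  "inner_semidirect G N H \<longleftrightarrow>
     N \<lhd> G \<and> subgroup H G \<and> N \<inter> H = {\<one>\<^bsub>G\<^esub>} \<and> N <#>\<^bsub>G\<^esub> H = carrier G"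

section \<open>Well-definedness of the notions above\<close>

lemma finite_if_wfp_on_both:
  fixes S :: "'g::linorder set"
  assumes lo: "wfp_on S (<)" and up: "wfp_on S (>)"
  shows "finite S"
proof -
  define B where "B = {x \<in> S. infinite {y \<in> S. y \<le> x}}"
  have "B = {}"
  proof (rule ccontr)
    assume "B \<noteq> {}"
    then obtain z where z: "z \<in> B" "\<And>y. y < z \<Longrightarrow> y \<notin> B"
      using lo[unfolded wfp_on_iff_ex_minimal] by (metis (no_types, lifting) B_def mem_Collect_eq subsetI)
    let ?L = "{y \<in> S. y < z}"
    have "{y \<in> S. y \<le> z} \<subseteq> insert z ?L" by auto
    then have inf: "infinite ?L"
      using z(1) finite_subset unfolding B_def by blast
    then have "?L \<noteq> {}" by (metis finite.emptyI)
    moreover have "?L \<subseteq> S" by auto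
    ultimately obtain w where w: "w \<in> ?L" "\<And>y. y > w \<Longrightarrow> y \<notin> ?L"
      using up[unfolded wfp_on_iff_ex_minimal] by meson
    have "finite {y \<in> S. y \<le> w}"
      using w(1) z(2) unfolding B_def by blast
    moreover have "?L \<subseteq> {y \<in> S. y \<le> w}"
      using w(2) not_less by blast
    ultimately show False using inf finite_subset by blast
  qed
  show ?thesis
  proof (cases "S = {}")
    case False
    then obtain m where m: "m \<in> S" "\<And>y. y > m \<Longrightarrow> y \<notin> S"
      using up[unfolded wfp_on_iff_ex_minimal] by blast
    then have "S \<subseteq> {y \<in> S. y \<le> m}" using not_less by blast
    moreover have "finite {y \<in> S. y \<le> m}" using \<open>B = {}\<close> m(1) unfolding B_def by blast
    ultimately show ?thesis using finite_subset by blast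
  qed simp
qed

lemma finite_convolution:
  fixes a b :: "'g::linordered_ab_group_add \<Rightarrow> 'k::field"
  assumes a: "a \<in> carrier hahn_ring" and b: "b \<in> carrier hahn_ring"
  shows "finite {h. h \<in> supp a \<and> g - h \<in> supp b}"
proof (rule finite_if_wfp_on_both)
  let ?S = "{h. h \<in> supp a \<and> g - h \<in> supp b}"
  show "wfp_on ?S (<)"
    using a by (auto simp: hahn_ring_def intro: wfp_on_subset)
  show "wfp_on ?S (>)"
    unfolding wfp_on_iff_ex_minimal
  proof (intro allI impI)
    fix B assume B: "B \<subseteq> ?S" "B \<noteq> {}"
    have "(\<lambda>h. g - h) ` B \<subseteq> supp b" "(\<lambda>h. g - h) ` B \<noteq> {}" using B by auto
    moreover have "wfp_on (supp b) (<)" using b by (simp add: hahn_ring_def)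
    ultimately obtain z where "z \<in> (\<lambda>h. g - h) ` B" "\<And>y. y < z \<Longrightarrow> y \<notin> (\<lambda>h. g - h) ` B"
      unfolding wfp_on_iff_ex_minimal by meson
    then obtain h where "h \<in> B" "\<And>y. y < g - h \<Longrightarrow> y \<notin> (\<lambda>h. g - h) ` B" by auto
    then show "\<exists>z\<in>B. \<forall>y. z < y \<longrightarrow> y \<notin> B"
      by (metis diff_strict_left_mono imageI)
  qed
qed

lemma supp_monomial: "supp (monomial c g) = (if c = 0 then {} else {g})"
  by (auto simp: supp_def monomial_def)

lemma monomial_neq_zero: "c \<noteq> 0 \<Longrightarrow> monomial c g \<noteq> \<zero>\<^bsub>hahn_ring\<^esub>"
  by (auto simp: hahn_ring_def monomial_def fun_eq_iff)

lemma val_monomial: "c \<noteq> 0 \<Longrightarrow> val (monomial c g) = Fin g"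
  by (simp add: val_def monomial_neq_zero supp_monomial Least_equality)

lemma group_ring_subset_rational_series: "group_ring \<subseteq> rational_series"
proof
  fix a :: "'g::linordered_ab_group_add \<Rightarrow> 'k::field"
  assume a: "a \<in> group_ring"
  then have fin: "finite (supp a)" by (simp add: group_ring_def)
  have "wfp_on (supp a) (<)"
    by (rule strict_partial_order_wfp_on_finite_set[OF _ _ fin]) auto
  then have car: "a \<in> carrier hahn_ring" by (simp add: hahn_ring_def)
  have "(\<Sum>h | h = 0 \<and> g - h \<in> supp a. monomial 1 0 h * a (g - h)) = a g" for g
  proof (cases "g \<in> supp a")
    case True
    then have "{h. h = 0 \<and> g - h \<in> supp a} = {0}" by auto
    then show ?thesis by (simp add: monomial_def)
  next
    case False
    then have e: "{h. h = 0 \<and> g - h \<in> supp a} = {}" by auto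
    show ?thesis using False unfolding e by (simp add: supp_def)
  qed
  then have "monomial 1 0 \<otimes>\<^bsub>hahn_ring\<^esub> a = a"
    by (simp add: hahn_ring_def supp_monomial fun_eq_iff)
  moreover have "monomial (1::'k) (0::'g) \<in> group_ring"
    by (simp add: group_ring_def supp_monomial)
  moreover have "monomial (1::'k) (0::'g) \<noteq> \<zero>\<^bsub>hahn_ring\<^esub>"
    by (simp add: monomial_neq_zero)
  ultimately show "a \<in> rational_series"
    using a car unfolding rational_series_def by blast
qed

lemma monomial_in_hahn_field:
  assumes "hahn_field K"
  shows "monomial c g \<in> K"
proof -
  have "monomial c g \<in> group_ring" by (simp add: group_ring_def supp_monomial)
  then show ?thesis
    using assms group_ring_subset_rational_series unfolding hahn_field_def by blast
qed

lemma induces_on_values_unique: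
  fixes K :: "('g::linordered_ab_group_add \<Rightarrow> 'k::field) set"
  assumes K: "hahn_field K"
    and s: "induces_on_values K \<sigma> s" and s': "induces_on_values K \<sigma> s'"
  shows "s = s'"
proof
  fix g
  have t: "tpow g \<in> K - {\<zero>\<^bsub>hahn_ring\<^esub>}"
    using monomial_in_hahn_field[OF K] by (simp add: monomial_neq_zero)
  have "map_extended s (val (tpow g :: 'g \<Rightarrow> 'k)) = val (\<sigma> (tpow g))"
       "map_extended s' (val (tpow g :: 'g \<Rightarrow> 'k)) = val (\<sigma> (tpow g))"
    using s s' t by (simp_all add: induces_on_values_def)
  moreover have v: "val (tpow g :: 'g \<Rightarrow> 'k) = Fin g" by (simp add: val_monomial)
  ultimately show "s g = s' g" by (metis extended.inject extended.map(1))
qed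

lemma val_pos_iff:
  fixes a :: "'g::linordered_ab_group_add \<Rightarrow> 'k::field"
  assumes "a \<in> carrier hahn_ring"
  shows "0 < val a \<longleftrightarrow> (\<forall>g\<le>0. a g = 0)"
proof (cases "a = \<zero>\<^bsub>hahn_ring\<^esub>")
  case True
  then have "val a = Pinf" by (simp add: val_def)
  then show ?thesis using True by (simp add: zero_extended_def hahn_ring_def)
next
  case False
  then have "supp a \<noteq> {}" by (auto simp: hahn_ring_def supp_def)
  moreover have "wfp_on (supp a) (<)" using assms by (simp add: hahn_ring_def)
  ultimately obtain m where m: "m \<in> supp a" "\<And>y. y < m \<Longrightarrow> y \<notin> supp a"
    unfolding wfp_on_iff_ex_minimal by (metis subset_refl)
  have L: "(LEAST g. g \<in> supp a) = m"
    by (rule Least_equality) (use m not_less in blast)+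
  have "0 < m \<longleftrightarrow> (\<forall>g\<le>0. g \<notin> supp a)"
    using m by (meson not_less order.strict_trans1)
  then have "0 < m \<longleftrightarrow> (\<forall>g\<le>0. a g = 0)" by (simp add: supp_def)
  then show ?thesis using False by (simp only: val_def L zero_extended_def if_False less_extended_simps)
qed

lemma residue_aut_coset:
  fixes K :: "('g::linordered_ab_group_add \<Rightarrow> 'k::field) set"
  assumes K: "hahn_field K" and \<sigma>: "\<sigma> \<in> v_Aut K" and a: "a \<in> val_ring K"
  shows "residue_aut K \<sigma> (val_ideal K +>\<^bsub>sub_hahn (val_ring K)\<^esub> a)
           = val_ideal K +>\<^bsub>sub_hahn (val_ring K)\<^esub> \<sigma> a"
proof -
  interpret F: field "sub_hahn K" using K by (simp add: hahn_field_def)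
  have KH: "K \<subseteq> carrier hahn_ring" using K by (simp add: hahn_field_def)
  define I where "I = val_ideal K"
  let ?p = "\<lambda>(x::'g \<Rightarrow> 'k) y g. x g + y g"
  have I_iff: "x \<in> I \<longleftrightarrow> x \<in> K \<and> (\<forall>g\<le>0. x g = 0)" for x
    using KH by (auto simp: I_def val_ideal_def val_pos_iff subset_iff)
  have zeroK: "(\<lambda>g. 0) \<in> K" using F.zero_closed by (simp add: hahn_ring_def)
  have addK: "x \<in> K \<Longrightarrow> y \<in> K \<Longrightarrow> ?p x y \<in> K" for x y
    using F.a_closed[of x y] by (simp add: hahn_ring_def)
  have negK: "(\<lambda>g. - x g) \<in> K" if x: "x \<in> K" for x
  proof -
    obtain y where y': "y \<in> K" "y \<oplus>\<^bsub>sub_hahn K\<^esub> x = \<zero>\<^bsub>sub_hahn K\<^esub>"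
      using F.a_inv_closed[of x] F.l_neg[of x] x by auto
    then have y: "y \<in> K" "?p y x = (\<lambda>g. 0)" by (simp_all add: hahn_ring_def)
    have "y = (\<lambda>g. - x g)"
    proof
      fix g show "y g = - x g" using fun_cong[OF y(2), of g] by (simp add: eq_neg_iff_add_eq_0)
    qed
    then show ?thesis using y(1) by simp
  qed
  have coset: "I +>\<^bsub>sub_hahn (val_ring K)\<^esub> x = {?p i x | i. i \<in> I}" for x
    by (auto simp: a_r_coset_def r_coset_def hahn_ring_def)
  have coset_eq: "{?p i (?p j x) | i. i \<in> I} = {?p i x | i. i \<in> I}" if j: "j \<in> I" for j x
  proof (intro equalityI subsetI)
    fix y assume "y \<in> {?p i (?p j x) | i. i \<in> I}"
    then obtain i where i: "i \<in> I" "y = ?p i (?p j x)" by blast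
    have "?p i j \<in> I" using i(1) j by (simp add: I_iff addK)
    moreover have "y = ?p (?p i j) x" using i(2) by (simp add: add.assoc)
    ultimately show "y \<in> {?p i x | i. i \<in> I}"
      by (intro CollectI exI[of _ "?p i j"]) simp
  next
    fix y assume "y \<in> {?p i x | i. i \<in> I}"
    then obtain i where i: "i \<in> I" "y = ?p i x" by blast
    have "?p i (\<lambda>g. - j g) \<in> I"
      using i(1) j addK[OF _ negK, of i j] by (simp add: I_iff)
    moreover have "y = ?p (?p i (\<lambda>g. - j g)) (?p j x)" using i(2) by (simp add: add.assoc)
    ultimately show "y \<in> {?p i (?p j x) | i. i \<in> I}"
      by (intro CollectI exI[of _ "?p i (\<lambda>g. - j g)"]) simp
  qed
  obtain s where s: "induces_on_values K \<sigma> s" using \<sigma> by (auto simp: v_Aut_def)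
  have hom: "\<sigma> \<in> ring_hom (sub_hahn K) (sub_hahn K)"
    using \<sigma> by (auto simp: v_Aut_def field_Aut_def ring_iso_def)
  have \<sigma>add: "x \<in> K \<Longrightarrow> y \<in> K \<Longrightarrow> \<sigma> (?p x y) = ?p (\<sigma> x) (\<sigma> y)" for x y
    using ring_hom_add[OF hom, of x y] by (simp add: hahn_ring_def)
  have \<sigma>K: "x \<in> K \<Longrightarrow> \<sigma> x \<in> K" for x
    using ring_hom_closed[OF hom, of x] by simp
  have \<sigma>0: "\<sigma> \<zero>\<^bsub>hahn_ring\<^esub> = \<zero>\<^bsub>hahn_ring\<^esub>"
  proof -
    have "\<sigma> (\<lambda>g. 0) = ?p (\<sigma> (\<lambda>g. 0)) (\<sigma> (\<lambda>g. 0))"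
      using \<sigma>add[OF zeroK zeroK] by simp
    then have "\<sigma> (\<lambda>g. 0) h = 0" for h
      using fun_cong[of _ _ h] by (metis add_cancel_right_right)
    then show ?thesis by (simp add: hahn_ring_def fun_eq_iff)
  qed
  have s0: "s 0 = 0" and sm: "strict_mono s"
  proof -
    have os: "order_aut s" using s by (simp add: induces_on_values_def)
    then have "s (0 + 0) = s 0 + s 0" unfolding order_aut_def by blast
    then show "s 0 = 0" by simp
    show "strict_mono s"
      using os unfolding order_aut_def by (simp add: bij_def strict_mono_iff_mono)
  qed
  have \<sigma>I: "\<sigma> i \<in> I" if i: "i \<in> I" for i
  proof (cases "i = \<zero>\<^bsub>hahn_ring\<^esub>")
    case True then show ?thesis using i \<sigma>0 by simp
  next
    case False
    have iK: "i \<in> K" and pos: "0 < val i" using i by (auto simp: I_def val_ideal_def)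
    have "map_extended s (val i) = val (\<sigma> i)"
      using s iK False by (simp add: induces_on_values_def)
    moreover have "0 < map_extended s (val i)"
      using pos s0 sm by (cases "val i") (auto simp: zero_extended_def dest: strict_monoD)
    ultimately show ?thesis using \<sigma>K[OF iK] by (simp add: I_def val_ideal_def)
  qed
  have aK: "a \<in> K" using a by (simp add: val_ring_def)
  have "(\<lambda>b. {?p i (\<sigma> b) | i. i \<in> I}) ` {?p i a | i. i \<in> I} = {{?p i (\<sigma> a) | i. i \<in> I}}"
  proof -
    have "{?p i (\<sigma> (?p j a)) | i. i \<in> I} = {?p i (\<sigma> a) | i. i \<in> I}" if j: "j \<in> I" for j
    proof -
      have "j \<in> K" using j by (simp add: I_iff)
      then show ?thesis using coset_eq[OF \<sigma>I[OF j], of "\<sigma> a"] \<sigma>add[OF _ aK] by simp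
    qed
    moreover have "(\<lambda>g. 0) \<in> I" by (simp add: I_iff zeroK)
    ultimately show ?thesis by (auto simp: image_iff) blast+
  qed
  moreover have "I +>\<^bsub>sub_hahn (val_ring K)\<^esub> a \<in> carrier (residue_field K)"
    using a by (auto simp: residue_field_def I_def FactRing_def A_RCOSETS_def' a_r_coset_def r_coset_def)
  ultimately show ?thesis
    by (simp add: residue_aut_def I_def[symmetric] coset)
qed

end

theory Submission
  imports Defs
begin

text \<open>
  An internal automorphism \<open>\<sigma>\<close> acts on leading terms through the numbers
  \<open>\<chi> g = \<sigma> (t\<^sup>g) g\<close>. If \<open>a\<close> has no exponents below \<open>g\<close>, then \<open>a = t\<^sup>g b\<close> with \<open>b\<close> in the
  valuation ring. Since \<open>\<sigma>\<close> preserves values and acts trivially on residues, the coefficient of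
  \<open>\<sigma> a = \<sigma> (t\<^sup>g) \<sigma> b\<close> at \<open>g\<close> is \<open>\<chi> g * b 0 = \<chi> g * a g\<close> (\<open>IntAut_leading_coeff\<close>).
  Applied to \<open>a = \<tau> (t\<^sup>g)\<close>, this makes \<open>\<sigma> \<mapsto> \<chi>\<close> a homomorphism from the internal automorphisms
  to the characters of the exponent group. Its kernel is the group of 1-automorphisms by definition,
  and the second lifting property says that \<open>x \<mapsto> \<rho>\<^sub>x\<close> is a homomorphic section of it. Hence the
  decomposition is that of a split epimorphism
  (\<open>inner_semidirect_if_split\<close>).

  The same applies to the automorphisms that fix all constants, because \<open>\<rho>\<^sub>x\<close> fixes the constants.
  Finally, an internal automorphism that maps constants to constants fixes each of
  them, as the residue of a constant determines it.
\<close>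

section \<open>Split epimorphisms\<close>

text \<open>The normal factor is the kernel of the epimorphism \<open>f\<close> and the complement is the image of its
  section \<open>s\<close>: an element \<open>x\<close> has the factorization \<open>x = (x (s (f x))\<inverse>) (s (f x))\<close>.\<close>

lemma inner_semidirect_if_split:
  assumes "group_hom G C f" and "group_hom C G s"
    and fs: "\<And>x. x \<in> carrier C \<Longrightarrow> f (s x) = x"
  shows "inner_semidirect G (kernel G C f) (s ` carrier C)"
proof -
  interpret f: group_hom G C f by fact
  interpret s: group_hom C G s by fact
  have "kernel G C f \<inter> s ` carrier C = {\<one>\<^bsub>G\<^esub>}"
  proof
    show "kernel G C f \<inter> s ` carrier C \<subseteq> {\<one>\<^bsub>G\<^esub>}"
      by (auto simp: kernel_def fs)
    show "{\<one>\<^bsub>G\<^esub>} \<subseteq> kernel G C f \<inter> s ` carrier C"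
      by (auto simp: kernel_def intro!: image_eqI[of _ _ "\<one>\<^bsub>C\<^esub>"])
  qed
  moreover have "kernel G C f <#>\<^bsub>G\<^esub> s ` carrier C = carrier G"
  proof
    show "kernel G C f <#>\<^bsub>G\<^esub> s ` carrier C \<subseteq> carrier G"
      by (auto simp: set_mult_def kernel_def)
    show "carrier G \<subseteq> kernel G C f <#>\<^bsub>G\<^esub> s ` carrier C"
    proof
      fix x assume x: "x \<in> carrier G"
      let ?n = "x \<otimes>\<^bsub>G\<^esub> inv\<^bsub>G\<^esub> s (f x)"
      have "?n \<in> kernel G C f" using x by (simp add: kernel_def fs)
      then have "?n \<otimes>\<^bsub>G\<^esub> s (f x) \<in> kernel G C f <#>\<^bsub>G\<^esub> s ` carrier C"
        using x f.hom_closed[OF x] unfolding set_mult_def by blast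
      then show "x \<in> kernel G C f <#>\<^bsub>G\<^esub> s ` carrier C"
        using x by (simp add: f.G.m_assoc)
    qed
  qed
  ultimately show ?thesis
    by (simp add: inner_semidirect_def f.normal_kernel s.img_is_subgroup)
qed

section \<open>Leading terms\<close>

lemma val_ge_iff:
  fixes a :: "'g::linordered_ab_group_add \<Rightarrow> 'k::field"
  assumes "a \<in> carrier hahn_ring"
  shows "Fin g \<le> val a \<longleftrightarrow> (\<forall>h<g. a h = 0)"
proof (cases "a = \<zero>\<^bsub>hahn_ring\<^esub>")
  case True
  then show ?thesis by (simp add: val_def) (simp add: hahn_ring_def)
next
  case False
  then have "supp a \<noteq> {}" by (auto simp: hahn_ring_def supp_def)
  moreover have "wfp_on (supp a) (<)" using assms by (simp add: hahn_ring_def)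
  ultimately obtain m where m: "m \<in> supp a" "\<And>y. y < m \<Longrightarrow> y \<notin> supp a"
    unfolding wfp_on_iff_ex_minimal by (metis subset_refl)
  have L: "(LEAST g. g \<in> supp a) = m"
    by (rule Least_equality) (use m not_less in blast)+
  have "g \<le> m \<longleftrightarrow> (\<forall>h<g. h \<notin> supp a)"
    using m by (meson not_less order.strict_trans2)
  then show ?thesis using False by (simp add: val_def L) (simp add: supp_def)
qed

lemma mult_monomial:
  fixes a :: "'g::linordered_ab_group_add \<Rightarrow> 'k::field"
  shows "monomial c g \<otimes>\<^bsub>hahn_ring\<^esub> a = (\<lambda>h. c * a (h - g))"
proof
  fix h
  have "(\<Sum>u | u \<in> supp (monomial c g) \<and> h - u \<in> supp a. monomial c g u * a (h - u))
      = (\<Sum>u\<in>{g}. monomial c g u * a (h - u))"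
    by (rule sum.mono_neutral_left) (auto simp: supp_monomial supp_def monomial_def split: if_splits)
  then show "(monomial c g \<otimes>\<^bsub>hahn_ring\<^esub> a) h = c * a (h - g)"
    by (simp add: hahn_ring_def monomial_def)
qed

text \<open>In the convolution sum at \<open>g + h\<close> only the product of the two leading terms survives.\<close>

lemma mult_leading_coeff:
  fixes a b :: "'g::linordered_ab_group_add \<Rightarrow> 'k::field"
  assumes a: "\<forall>u<g. a u = 0" and b: "\<forall>u<h. b u = 0"
  shows "(a \<otimes>\<^bsub>hahn_ring\<^esub> b) (g + h) = a g * b h"
proof -
  have sub: "{u. u \<in> supp a \<and> g + h - u \<in> supp b} \<subseteq> {g}"
  proof
    fix u assume "u \<in> {u. u \<in> supp a \<and> g + h - u \<in> supp b}"
    then have "\<not> u < g" "\<not> g + h - u < h" using a b by (auto simp: supp_def)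
    then show "u \<in> {g}" by (simp add: not_less le_diff_eq add.commute)
  qed
  have "(\<Sum>u | u \<in> supp a \<and> g + h - u \<in> supp b. a u * b (g + h - u))
      = (\<Sum>u\<in>{g}. a u * b (g + h - u))"
    by (rule sum.mono_neutral_left) (use sub in \<open>auto simp: supp_def\<close>)
  then show ?thesis by (simp add: hahn_ring_def)
qed

section \<open>Hahn fields and their residues\<close>

lemma hahn_field_mult:
  assumes "hahn_field K" "a \<in> K" "b \<in> K"
  shows "a \<otimes>\<^bsub>hahn_ring\<^esub> b \<in> K"
proof -
  interpret field "sub_hahn K" using assms(1) by (simp add: hahn_field_def)
  show ?thesis using m_closed[of a b] assms by simp
qed

lemma hahn_field_add:
  assumes "hahn_field K" "a \<in> K" "b \<in> K"
  shows "(\<lambda>g. a g + b g) \<in> K"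
proof -
  interpret field "sub_hahn K" using assms(1) by (simp add: hahn_field_def)
  show ?thesis using a_closed[of a b] assms by (simp add: hahn_ring_def)
qed

text \<open>Multiplication by the constant \<open>-1\<close> gives pointwise negation.\<close>

lemma hahn_field_diff:
  assumes "hahn_field K" "a \<in> K" "b \<in> K"
  shows "(\<lambda>g. a g - b g) \<in> K"
  using hahn_field_add[OF assms(1,2)
      hahn_field_mult[OF assms(1) monomial_in_hahn_field[OF assms(1), of "-1" 0] assms(3)]]
  by (simp add: mult_monomial)

lemma val_ring_iff:
  assumes "hahn_field K"
  shows "a \<in> val_ring K \<longleftrightarrow> a \<in> K \<and> (\<forall>h<0. a h = 0)"
  using assms by (auto simp: val_ring_def hahn_field_def zero_extended_def val_ge_iff subset_iff)

lemma val_ideal_iff: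
  assumes "hahn_field K"
  shows "a \<in> val_ideal K \<longleftrightarrow> a \<in> K \<and> (\<forall>h\<le>0. a h = 0)"
  using assms by (auto simp: val_ideal_def hahn_field_def val_pos_iff subset_iff)

lemma val_ideal_coset:
  assumes K: "hahn_field K" and a: "a \<in> val_ring K"
  shows "val_ideal K +>\<^bsub>sub_hahn (val_ring K)\<^esub> a = {b \<in> val_ring K. b 0 = a 0}"
proof -
  have "val_ideal K +>\<^bsub>sub_hahn (val_ring K)\<^esub> a = {(\<lambda>g. i g + a g) | i. i \<in> val_ideal K}"
    by (auto simp: a_r_coset_def r_coset_def hahn_ring_def)
  also have "\<dots> = {b \<in> val_ring K. b 0 = a 0}"
  proof (intro equalityI subsetI)
    fix b assume "b \<in> {b \<in> val_ring K. b 0 = a 0}"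
    then have b: "b \<in> val_ring K" "b 0 = a 0" by auto
    then have "(\<lambda>g. b g - a g) \<in> val_ideal K"
      using a K hahn_field_diff[OF K, of b a]
      by (auto simp: val_ideal_iff val_ring_iff order.order_iff_strict)
    then show "b \<in> {(\<lambda>g. i g + a g) | i. i \<in> val_ideal K}"
      by (intro CollectI exI[of _ "\<lambda>g. b g - a g"]) simp
  qed (use a K hahn_field_add[OF K] in \<open>auto simp: val_ideal_iff val_ring_iff\<close>)
  finally show ?thesis .
qed

lemma carrier_residue_field:
  "carrier (residue_field K) = (\<lambda>a. val_ideal K +>\<^bsub>sub_hahn (val_ring K)\<^esub> a) ` val_ring K"
  by (auto simp: residue_field_def FactRing_def A_RCOSETS_def' a_r_coset_def r_coset_def)

section \<open>Internal automorphisms\<close>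

lemma field_Aut_hom:
  assumes "\<sigma> \<in> field_Aut K"
  shows "\<sigma> \<in> ring_hom (sub_hahn K) (sub_hahn K)" "bij_betw \<sigma> K K" "\<sigma> \<in> extensional K"
  using assms by (auto simp: field_Aut_def ring_iso_def)

lemma field_Aut_mult:
  assumes "\<sigma> \<in> field_Aut K" "a \<in> K" "b \<in> K"
  shows "\<sigma> (a \<otimes>\<^bsub>hahn_ring\<^esub> b) = \<sigma> a \<otimes>\<^bsub>hahn_ring\<^esub> \<sigma> b"
  using ring_hom_mult[OF field_Aut_hom(1)[OF assms(1)], of a b] assms by simp

lemma field_Aut_closed: "\<sigma> \<in> field_Aut K \<Longrightarrow> a \<in> K \<Longrightarrow> \<sigma> a \<in> K"
  using ring_hom_closed[OF field_Aut_hom(1)] by fastforce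

lemma field_Aut_zero:
  assumes "hahn_field K" "\<sigma> \<in> field_Aut K"
  shows "\<sigma> \<zero>\<^bsub>hahn_ring\<^esub> = \<zero>\<^bsub>hahn_ring\<^esub>"
proof -
  interpret field "sub_hahn K" using assms(1) by (simp add: hahn_field_def)
  show ?thesis using ring_hom_zero[OF field_Aut_hom(1)[OF assms(2)] ring_axioms ring_axioms] by simp
qed

text \<open>Cosets of the valuation ideal can be replaced by coefficients, since two elements of the
  valuation ring have the same residue if and only if they have the same coefficient at \<open>0\<close>.\<close>

lemma IntAut_iff:
  assumes K: "hahn_field K"
  shows "\<sigma> \<in> IntAut K \<longleftrightarrow> \<sigma> \<in> field_Aut K \<and> (\<forall>a\<in>K. val (\<sigma> a) = val a)
    \<and> (\<forall>a\<in>val_ring K. \<sigma> a 0 = a 0)"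
    (is "_ \<longleftrightarrow> _ \<and> ?V \<and> ?R")
proof -
  have value_iff: "induces_on_values K \<sigma> id \<longleftrightarrow> ?V" if "\<sigma> \<in> field_Aut K"
  proof -
    have "order_aut (id :: 'a \<Rightarrow> 'a)" by (simp add: order_aut_def mono_def)
    then have "induces_on_values K \<sigma> id \<longleftrightarrow> (\<forall>a\<in>K - {\<zero>\<^bsub>hahn_ring\<^esub>}. val (\<sigma> a) = val a)"
      unfolding induces_on_values_def extended.map_id by (metis (no_types))
    then show ?thesis using field_Aut_zero[OF K that] by (metis (no_types) DiffI singletonD DiffD1)
  qed
  have residue_iff: "residue_aut K \<sigma> = (\<lambda>C\<in>carrier (residue_field K). C) \<longleftrightarrow> ?R"
    if \<sigma>: "\<sigma> \<in> field_Aut K" and V: ?V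
  proof -
    let ?c = "\<lambda>a. val_ideal K +>\<^bsub>sub_hahn (val_ring K)\<^esub> a"
    have vA: "\<sigma> \<in> v_Aut K" using \<sigma> V value_iff[OF \<sigma>] by (auto simp: v_Aut_def)
    have closed: "\<sigma> a \<in> val_ring K" if "a \<in> val_ring K" for a
      using that V field_Aut_closed[OF \<sigma>] by (auto simp: val_ring_def)
    have "residue_aut K \<sigma> = (\<lambda>C\<in>carrier (residue_field K). C)
      \<longleftrightarrow> (\<forall>C\<in>carrier (residue_field K). residue_aut K \<sigma> C = C)"
      by (auto simp: residue_aut_def fun_eq_iff restrict_def)
    also have "\<dots> \<longleftrightarrow> (\<forall>a\<in>val_ring K. ?c (\<sigma> a) = ?c a)"
      by (simp add: carrier_residue_field residue_aut_coset[OF K vA])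
    also have "\<dots> \<longleftrightarrow> ?R"
      using closed by (auto simp: val_ideal_coset[OF K])
    finally show ?thesis .
  qed
  show ?thesis using value_iff residue_iff by (auto simp: IntAut_def v_Aut_def)
qed

lemma IntAut_vanishes_below:
  assumes K: "hahn_field K" and \<sigma>: "\<sigma> \<in> IntAut K" and a: "a \<in> K" "\<forall>h<g. a h = 0"
  shows "\<forall>h<g. \<sigma> a h = 0"
proof -
  have "\<sigma> a \<in> K" "val (\<sigma> a) = val a"
    using \<sigma> a(1) field_Aut_closed by (auto simp: IntAut_iff[OF K])
  moreover have "K \<subseteq> carrier hahn_ring" using K by (simp add: hahn_field_def)
  ultimately show ?thesis using a by (metis val_ge_iff subsetD)
qed

text \<open>The factorization \<open>a = t\<^sup>g b\<close> moves the leading term of \<open>a\<close> to the exponent \<open>0\<close>, where the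
  trivial action of \<open>\<sigma>\<close> on residues applies.\<close>

lemma IntAut_leading_coeff:
  assumes K: "hahn_field K" and \<sigma>: "\<sigma> \<in> IntAut K" and a: "a \<in> K" "\<forall>h<g. a h = 0"
  shows "\<sigma> a g = \<sigma> (tpow g) g * a g"
proof -
  note F = \<sigma>[unfolded IntAut_iff[OF K], THEN conjunct1]
  define b where "b = (\<lambda>h. a (h + g))"
  have "b = tpow (- g) \<otimes>\<^bsub>hahn_ring\<^esub> a" by (simp add: b_def mult_monomial)
  then have "b \<in> K"
    using a(1) hahn_field_mult[OF K monomial_in_hahn_field[OF K]] by simp
  moreover have below: "\<forall>h<0. b h = 0"
    using a(2) by (simp add: b_def)
  ultimately have b: "b \<in> val_ring K" using K by (simp add: val_ring_iff)
  have "a = tpow g \<otimes>\<^bsub>hahn_ring\<^esub> b" by (simp add: b_def mult_monomial)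
  then have "\<sigma> a = \<sigma> (tpow g) \<otimes>\<^bsub>hahn_ring\<^esub> \<sigma> b"
    using field_Aut_mult[OF F monomial_in_hahn_field[OF K] \<open>b \<in> K\<close>] by simp
  moreover have "\<forall>h<g. \<sigma> (tpow g) h = 0"
    using IntAut_vanishes_below[OF K \<sigma> monomial_in_hahn_field[OF K], of g 1 g]
    by (auto simp: monomial_def)
  ultimately have "\<sigma> a (g + 0) = \<sigma> (tpow g) g * \<sigma> b 0"
    using mult_leading_coeff[OF _ IntAut_vanishes_below[OF K \<sigma> \<open>b \<in> K\<close> below]] by metis
  also have "\<sigma> b 0 = a g"
    using \<sigma> b by (simp add: IntAut_iff[OF K]) (simp add: b_def)
  finally show ?thesis by simp
qed

section \<open>Groups of automorphisms\<close>

text \<open>In terms of coefficients both conditions on an internal automorphism read \<open>q (\<sigma> a) = q a\<close>, with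
  \<open>q\<close> the value or the coefficient at \<open>0\<close>. Such conditions pass to compositions, and to the inverse
  by substituting \<open>a = \<sigma>\<inverse> b\<close>, which lies in the valuation ring whenever \<open>b\<close> does.\<close>

lemma subgroup_IntAut:
  assumes K: "hahn_field K"
  shows "subgroup (IntAut K) (BijGroup K)"
proof -
  interpret field "sub_hahn K" using K by (simp add: hahn_field_def)
  interpret B: group "BijGroup K" by (rule group_BijGroup)
  have bij: "\<sigma> \<in> Bij K" if "\<sigma> \<in> field_Aut K" for \<sigma>
    using field_Aut_hom[OF that] by (simp add: Bij_def)
  show ?thesis
  proof (rule B.subgroupI)
    show "IntAut K \<subseteq> carrier (BijGroup K)"
      using bij by (auto simp: BijGroup_def IntAut_iff[OF K])
    have "(\<lambda>a\<in>K. a) \<in> field_Aut K"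
      using ring_iso_restrict[OF ring_iso_set_refl, of "\<lambda>a\<in>K. a"] by (simp add: field_Aut_def)
    then have "(\<lambda>a\<in>K. a) \<in> IntAut K" by (auto simp: IntAut_iff[OF K] val_ring_def)
    then show "IntAut K \<noteq> {}" by blast
  next
    fix \<sigma> assume \<sigma>: "\<sigma> \<in> IntAut K"
    note F = \<sigma>[unfolded IntAut_iff[OF K], THEN conjunct1]
    define \<tau> where "\<tau> = restrict (inv_into K \<sigma>) K"
    have inv: "inv\<^bsub>BijGroup K\<^esub> \<sigma> = \<tau>" unfolding \<tau>_def by (rule inv_BijGroup[OF bij[OF F]])
    have bb: "bij_betw \<sigma> K K" by (rule field_Aut_hom(2)[OF F])
    have "inv_into K \<sigma> \<in> ring_iso (sub_hahn K) (sub_hahn K)"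
      using ring_iso_set_sym[OF ring_axioms, of \<sigma> "sub_hahn K"] F by (simp add: field_Aut_def)
    then have "\<tau> \<in> ring_iso (sub_hahn K) (sub_hahn K)"
      by (rule ring_iso_restrict) (simp add: \<tau>_def)
    then have "\<tau> \<in> field_Aut K" by (simp add: field_Aut_def \<tau>_def)
    moreover have right: "\<tau> a \<in> K" "\<sigma> (\<tau> a) = a" if "a \<in> K" for a
      using that bb by (auto simp: \<tau>_def bij_betw_def f_inv_into_f inv_into_into)
    moreover have val: "val (\<tau> a) = val a" if "a \<in> K" for a
      using \<sigma> right[OF that] unfolding IntAut_iff[OF K] by metis
    moreover have "\<tau> a 0 = a 0" if a: "a \<in> val_ring K" for a
    proof -
      have "a \<in> K" using a by (simp add: val_ring_def)
      moreover from this have "\<tau> a \<in> val_ring K"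
        using a right val by (simp add: val_ring_def)
      ultimately show ?thesis
        using \<sigma> right unfolding IntAut_iff[OF K] by metis
    qed
    ultimately show "inv\<^bsub>BijGroup K\<^esub> \<sigma> \<in> IntAut K" by (simp add: inv IntAut_iff[OF K])
  next
    fix \<sigma> \<tau> assume \<sigma>\<tau>: "\<sigma> \<in> IntAut K" "\<tau> \<in> IntAut K"
    then have F: "\<sigma> \<in> field_Aut K" "\<tau> \<in> field_Aut K" by (auto simp: IntAut_iff[OF K])
    have "\<sigma> \<circ> \<tau> \<in> ring_iso (sub_hahn K) (sub_hahn K)"
      using ring_iso_set_trans[of \<tau> "sub_hahn K" "sub_hahn K" \<sigma> "sub_hahn K"] F
      by (simp add: field_Aut_def)
    then have "compose K \<sigma> \<tau> \<in> ring_iso (sub_hahn K) (sub_hahn K)"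
      by (rule ring_iso_restrict) (simp add: compose_eq)
    then have "compose K \<sigma> \<tau> \<in> field_Aut K" by (simp add: field_Aut_def)
    moreover have "val (compose K \<sigma> \<tau> a) = val a" if "a \<in> K" for a
      using that \<sigma>\<tau> field_Aut_closed[OF F(2)] by (simp add: compose_eq IntAut_iff[OF K])
    moreover have "compose K \<sigma> \<tau> a 0 = a 0" if "a \<in> val_ring K" for a
      using that \<sigma>\<tau> field_Aut_closed[OF F(2)] by (auto simp: compose_eq IntAut_iff[OF K] val_ring_def)
    ultimately show "\<sigma> \<otimes>\<^bsub>BijGroup K\<^esub> \<tau> \<in> IntAut K"
      using F by (simp add: BijGroup_def bij IntAut_iff[OF K])
  qed
qed

lemma aut_group_mult:
  assumes "subgroup A (BijGroup K)" "\<sigma> \<in> A" "\<tau> \<in> A"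
  shows "\<sigma> \<otimes>\<^bsub>aut_group K A\<^esub> \<tau> = compose K \<sigma> \<tau>"
  using assms subgroup.subset[OF assms(1)] by (auto simp: aut_group_def BijGroup_def)

lemma group_aut_group: "subgroup A (BijGroup K) \<Longrightarrow> group (aut_group K A)"
  unfolding aut_group_def by (rule subgroup.subgroup_is_group[OF _ group_BijGroup])

lemma constants_subset: "hahn_field K \<Longrightarrow> constants \<subseteq> K"
  by (auto simp: constants_def monomial_in_hahn_field)

lemma subgroup_fixing_constants:
  assumes K: "hahn_field K"
  shows "subgroup (fixing_constants (IntAut K)) (BijGroup K)"
proof -
  interpret B: group "BijGroup K" by (rule group_BijGroup)
  interpret I: subgroup "IntAut K" "BijGroup K" by (rule subgroup_IntAut[OF K])
  note cK = subsetD[OF constants_subset[OF K]]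
  have Bij: "\<sigma> \<in> Bij K" if "\<sigma> \<in> IntAut K" for \<sigma>
    using I.subset that by (auto simp: BijGroup_def)
  show ?thesis
  proof (rule B.subgroupI)
    show "fixing_constants (IntAut K) \<subseteq> carrier (BijGroup K)"
      using I.subset by (auto simp: fixing_constants_def)
    have "\<one>\<^bsub>BijGroup K\<^esub> \<in> fixing_constants (IntAut K)"
      using I.one_closed cK by (auto simp: fixing_constants_def BijGroup_def)
    then show "fixing_constants (IntAut K) \<noteq> {}" by blast
  next
    fix \<sigma> assume \<sigma>: "\<sigma> \<in> fixing_constants (IntAut K)"
    then have I: "\<sigma> \<in> IntAut K" by (simp add: fixing_constants_def)
    have "inj_on \<sigma> K" using Bij[OF I] by (auto simp: Bij_def bij_betw_def)
    then have "inv_into K \<sigma> c = c" if "c \<in> constants" for c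
      using \<sigma> that cK[OF that] by (metis (mono_tags, lifting) fixing_constants_def inv_into_f_f mem_Collect_eq)
    then show "inv\<^bsub>BijGroup K\<^esub> \<sigma> \<in> fixing_constants (IntAut K)"
      using I.m_inv_closed[OF I] cK by (auto simp: fixing_constants_def inv_BijGroup[OF Bij[OF I]])
  next
    fix \<sigma> \<tau> assume st: "\<sigma> \<in> fixing_constants (IntAut K)" "\<tau> \<in> fixing_constants (IntAut K)"
    then have I: "\<sigma> \<in> IntAut K" "\<tau> \<in> IntAut K" by (auto simp: fixing_constants_def)
    then have "\<sigma> \<otimes>\<^bsub>BijGroup K\<^esub> \<tau> = compose K \<sigma> \<tau>" by (simp add: BijGroup_def Bij)
    then show "\<sigma> \<otimes>\<^bsub>BijGroup K\<^esub> \<tau> \<in> fixing_constants (IntAut K)"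
      using I.m_closed[OF I] st cK by (simp add: fixing_constants_def compose_eq)
  qed
qed

text \<open>The constants have no negative exponents, so \<open>\<sigma> c\<close> has the same residue as \<open>c\<close>. If \<open>\<sigma> c\<close> is
  itself a constant, this residue is all of it.\<close>

lemma stabilizing_eq_fixing_constants:
  assumes K: "hahn_field K"
  shows "stabilizing_constants (IntAut K) = fixing_constants (IntAut K)"
proof -
  have "\<sigma> c = c" if \<sigma>: "\<sigma> \<in> IntAut K" "\<sigma> ` constants = constants" and c: "c \<in> constants" for \<sigma> c
  proof -
    have "\<sigma> c \<in> constants" using \<sigma>(2) c by blast
    then obtain d e where de: "c = monomial d 0" "\<sigma> c = monomial e 0"
      using c by (auto simp: constants_def)
    have "c \<in> val_ring K"
      using monomial_in_hahn_field[OF K] by (simp add: de(1) val_ring_iff[OF K]) (simp add: monomial_def)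
    then have "\<sigma> c 0 = c 0" using \<sigma>(1) by (simp add: IntAut_iff[OF K])
    then have "e = d" unfolding de(2) unfolding de(1) by (simp add: monomial_def)
    then show ?thesis using de by simp
  qed
  moreover have "\<sigma> ` constants = constants" if "\<forall>c\<in>constants. \<sigma> c = c"
    for \<sigma> :: "('a \<Rightarrow> 'b) \<Rightarrow> 'a \<Rightarrow> 'b"
    using that by simp
  ultimately show ?thesis unfolding stabilizing_constants_def fixing_constants_def by blast
qed

section \<open>The decomposition\<close>

lemma group_character_group:
  "group (character_group :: ('g::linordered_ab_group_add \<Rightarrow> 'k::field) monoid)"
proof (rule groupI)
  fix x :: "'g \<Rightarrow> 'k" assume x: "x \<in> carrier character_group"
  then show "\<exists>y\<in>carrier character_group. y \<otimes>\<^bsub>character_group\<^esub> x = \<one>\<^bsub>character_group\<^esub>"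
    by (intro bexI[of _ "\<lambda>g. inverse (x g)"]) (auto simp: character_group_def)
qed (auto simp: character_group_def mult_ac)

definition leading_character ::
    "(('g::linordered_ab_group_add \<Rightarrow> 'k::field) \<Rightarrow> ('g \<Rightarrow> 'k)) \<Rightarrow> ('g \<Rightarrow> 'k)" where
  "leading_character \<sigma> = (\<lambda>g. \<sigma> (tpow g) g)"

lemma leading_character_in_character_group:
  assumes K: "hahn_field K" and \<sigma>: "\<sigma> \<in> IntAut K"
  shows "leading_character \<sigma> \<in> carrier character_group"
proof -
  note F = \<sigma>[unfolded IntAut_iff[OF K], THEN conjunct1]
  note t = monomial_in_hahn_field[OF K]
  have below: "\<forall>h<g. \<sigma> (tpow g) h = 0" for g
    using IntAut_vanishes_below[OF K \<sigma> t, of g 1 g] by (auto simp: monomial_def)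
  have "leading_character \<sigma> (g + h) = leading_character \<sigma> g * leading_character \<sigma> h" for g h
  proof -
    have "tpow (g + h) = tpow g \<otimes>\<^bsub>hahn_ring\<^esub> (tpow h :: 'a \<Rightarrow> 'b)"
      unfolding mult_monomial by (auto simp: monomial_def fun_eq_iff)
    then show ?thesis
      using field_Aut_mult[OF F t t] mult_leading_coeff[OF below below]
      by (simp add: leading_character_def)
  qed
  \<comment> \<open>As \<open>\<sigma>\<close> is onto, some \<open>a\<close> is mapped to \<open>t\<^sup>g\<close>; it has value \<open>g\<close>, and \<open>\<chi> g\<close> divides \<open>1\<close>.\<close>
  moreover have "leading_character \<sigma> g \<noteq> 0" for g
  proof -
    obtain a where a: "a \<in> K" "\<sigma> a = tpow g"
      using field_Aut_hom(2)[OF F] t by (metis bij_betw_imp_surj_on imageE)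
    then have "val a = Fin g"
      using \<sigma> by (metis IntAut_iff[OF K] val_monomial zero_neq_one)
    moreover have "a \<in> carrier hahn_ring" using a(1) K by (auto simp: hahn_field_def)
    ultimately have "\<forall>h<g. a h = 0" using val_ge_iff[of a g] by simp
    then have "1 = leading_character \<sigma> g * a g"
      using IntAut_leading_coeff[OF K \<sigma> a(1)] fun_cong[OF a(2), of g]
      unfolding leading_character_def by (simp add: monomial_def[of 1 g])
    then show ?thesis by auto
  qed
  ultimately show ?thesis by (simp add: character_group_def)
qed

text \<open>The leading coefficient of \<open>\<tau> (t\<^sup>g)\<close> is the character of \<open>\<tau>\<close> at \<open>g\<close>, and \<open>\<sigma>\<close> multiplies a
  leading coefficient at \<open>g\<close> by its own character at \<open>g\<close>.\<close>

lemma leading_character_compose: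
  assumes K: "hahn_field K" and \<sigma>: "\<sigma> \<in> IntAut K" and \<tau>: "\<tau> \<in> IntAut K"
  shows "leading_character (compose K \<sigma> \<tau>) = (\<lambda>g. leading_character \<sigma> g * leading_character \<tau> g)"
proof
  fix g
  note t = monomial_in_hahn_field[OF K]
  have "\<tau> (tpow g) \<in> K" using \<tau> t unfolding IntAut_iff[OF K] by (blast intro: field_Aut_closed)
  moreover have "\<forall>h<g. \<tau> (tpow g) h = 0"
    using IntAut_vanishes_below[OF K \<tau> t, of g 1 g] by (auto simp: monomial_def)
  ultimately show "leading_character (compose K \<sigma> \<tau>) g = leading_character \<sigma> g * leading_character \<tau> g"
    using IntAut_leading_coeff[OF K \<sigma>] t by (simp add: leading_character_def compose_eq)
qed

lemma leading_character_exponentiation: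
  "hahn_field K \<Longrightarrow> leading_character (exponentiation K x) = x"
  by (simp add: leading_character_def exponentiation_def monomial_in_hahn_field)
    (simp add: monomial_def)

lemma exponentiation_fixes_constants:
  assumes "hahn_field K" "x \<in> carrier character_group" "c \<in> constants"
  shows "exponentiation K x c = c"
proof -
  have "x 0 \<noteq> 0" and mult: "x (g + h) = x g * x h" for g h
    using assms(2) by (simp_all add: character_group_def)
  then have x: "x 0 = 1" using mult[of 0 0] by simp
  obtain d where c: "c = monomial d 0" using assms(3) by (auto simp: constants_def)
  have "exponentiation K x c = (\<lambda>g. c g * x g)"
    using monomial_in_hahn_field[OF assms(1)] by (simp add: exponentiation_def c)
  also have "\<dots> = c" by (simp add: c monomial_def x fun_eq_iff)
  finally show ?thesis .
qed

text \<open>Both decompositions are instances, with \<open>A\<close> the group of all internal automorphisms and the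
  group of those that fix the constants.\<close>

lemma inner_semidirect_G_Exp:
  assumes K: "hahn_field K" and lift: "canonical_second_lifting K"
    and A: "subgroup A (BijGroup K)" "A \<subseteq> IntAut K" "G_Exp K \<subseteq> A"
  shows "inner_semidirect (aut_group K A) {\<sigma> \<in> A. \<forall>g. \<sigma> (tpow g) g = 1} (G_Exp K)"
proof -
  let ?G = "aut_group K A"
  have car: "carrier ?G = A" by (simp add: aut_group_def)
  have "leading_character \<in> hom ?G character_group"
  proof (rule homI)
    fix \<sigma> \<tau> assume "\<sigma> \<in> carrier ?G" "\<tau> \<in> carrier ?G"
    then have st: "\<sigma> \<in> A" "\<tau> \<in> A" by (simp_all add: car)
    then show "leading_character (\<sigma> \<otimes>\<^bsub>?G\<^esub> \<tau>)
        = leading_character \<sigma> \<otimes>\<^bsub>character_group\<^esub> leading_character \<tau>"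
      using leading_character_compose[OF K, of \<sigma> \<tau>] A(2)
      by (auto simp: aut_group_mult[OF A(1)] character_group_def)
  qed (use A(2) leading_character_in_character_group[OF K] in \<open>auto simp: car\<close>)
  then have f: "group_hom ?G character_group leading_character"
    by (simp add: group_hom_def group_hom_axioms_def group_aut_group[OF A(1)] group_character_group)
  have "exponentiation K \<in> hom character_group ?G"
    using lift A(3) by (auto simp: canonical_second_lifting_def hom_def aut_group_def G_Exp_def)
  then have s: "group_hom character_group ?G (exponentiation K)"
    by (simp add: group_hom_def group_hom_axioms_def group_aut_group[OF A(1)] group_character_group)
  have "kernel ?G character_group leading_character = {\<sigma> \<in> A. \<forall>g. \<sigma> (tpow g) g = 1}"
    by (auto simp: kernel_def car leading_character_def character_group_def fun_eq_iff)
  then show ?thesis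
    using inner_semidirect_if_split[OF f s] leading_character_exponentiation[OF K]
    by (simp add: G_Exp_def)
qed

theorem theorem3p4p1:
  fixes K :: "('g::linordered_ab_group_add \<Rightarrow> 'k::field) set"
  assumes "hahn_field K"
    and "canonical_second_lifting K"
  shows "inner_semidirect (aut_group K (IntAut K)) (one_Aut K) (G_Exp K)
    \<and> stabilizing_constants (IntAut K) = fixing_constants (IntAut K)
    \<and> inner_semidirect (aut_group K (fixing_constants (IntAut K)))
         (fixing_constants (one_Aut K)) (G_Exp K)"
proof (intro conjI)
  have exp: "G_Exp K \<subseteq> IntAut K"
    using assms(2) by (auto simp: canonical_second_lifting_def hom_def aut_group_def G_Exp_def)
  show "inner_semidirect (aut_group K (IntAut K)) (one_Aut K) (G_Exp K)"
    using inner_semidirect_G_Exp[OF assms subgroup_IntAut[OF assms(1)] order_refl exp]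
    by (simp add: one_Aut_def)
  show "stabilizing_constants (IntAut K) = fixing_constants (IntAut K)"
    by (rule stabilizing_eq_fixing_constants[OF assms(1)])
  have sub: "fixing_constants (IntAut K) \<subseteq> IntAut K" by (auto simp: fixing_constants_def)
  have exp': "G_Exp K \<subseteq> fixing_constants (IntAut K)"
    using exp exponentiation_fixes_constants[OF assms(1)]
    by (auto simp: fixing_constants_def G_Exp_def)
  have "{\<sigma> \<in> fixing_constants (IntAut K). \<forall>g. \<sigma> (tpow g) g = 1} = fixing_constants (one_Aut K)"
    by (auto simp: fixing_constants_def one_Aut_def)
  then show "inner_semidirect (aut_group K (fixing_constants (IntAut K)))
      (fixing_constants (one_Aut K)) (G_Exp K)"
    using inner_semidirect_G_Exp[OF assms subgroup_fixing_constants[OF assms(1)] sub exp'] by simp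
qed

end
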